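(* Let $n$ be a positive integer. Then there exists $\varrho>0$ such that $D_\varrho\cap\{\Re\le 0\}\subset\mathcal{S}_n$ if and only if $n\equiv 0 \pmod 4$ or $n\equiv 3\pmod 4$.
   Context: For a positive integer $n$ let $\mathcal{P}_n(z):=\sum_{k=0}^n \frac{(nz)^k}{k!}$ (with $0^0=1$) and $\mathcal{S}_n:=\{z\in\mathbb{C} : |\mathcal{P}_n(z)|\le 1\}$. For $\varrho>0$, $D_\varrho:=\{z\in\mathbb{C}: |z|\le\varrho\}$ is the closed disk of radius $\varrho$ centered at $0$, and $\{\Re\le 0\}:=\{z\in\mathbb{C}:\Re(z)\le 0\}$. *)

theory Defs
  imports "HOL-Analysis.Analysis" "HOL-Number_Theory.Cong"
begin

definition scaled_exp_poly :: "nat \<Rightarrow> complex \<Rightarrow> complex" where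
  "scaled_exp_poly n z = (\<Sum>k=0..n. (of_nat n * z) ^ k / fact k)"

definition stability_set :: "nat \<Rightarrow> complex set" where
  "stability_set n = {z. cmod (scaled_exp_poly n z) \<le> 1}"

end

theory Submission
  imports Defs
begin

text \<open>
  Write \<open>T\<close> for the Taylor section \<open>\<Sum>k\<le>n. w ^ k / k!\<close> of the exponential function, so that the
  polynomial in question is \<open>T (n z)\<close> and only the size of \<open>T\<close> near \<open>0\<close> matters.  The proof rests on
  the identity \<open>T' = T - w ^ n / n!\<close>, which controls \<open>\<bar>T\<bar>\<^sup>2\<close> in the two coordinate directions.

  In the horizontal direction the derivative of \<open>\<bar>T\<bar>\<^sup>2\<close> is \<open>2 Re (cnj T * T')\<close>.  This equals \<open>2\<close>
  at the origin and so is positive nearby: \<open>\<bar>T\<bar>\<close> increases from left to right, and its bound on the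
  left half plane is decided on the imaginary axis (\<open>cmod_exp_section_le_imaginary_axis\<close>).

  On the imaginary axis the contribution of the summand \<open>T\<close> of \<open>T'\<close> is \<open>Re (\<i> \<bar>T\<bar>\<^sup>2) = 0\<close>.  What
  remains of the derivative of \<open>\<bar>T(\<i> y)\<bar>\<^sup>2\<close> is
  \<open>- 2 (y ^ n / n!) Re (\<i> ^ (n+1) cnj (T(\<i> y)))\<close>.  As \<open>T(\<i> y) = 1 + \<i> y + O(y\<^sup>2)\<close>, both its real and
  its imaginary part are positive for small \<open>y > 0\<close>, and the last factor is, for
  \<open>n \<equiv> 0, 1, 2, 3\<close> modulo \<open>4\<close>, equal to \<open>Im T\<close>, \<open>- Re T\<close>, \<open>- Im T\<close>, \<open>Re T\<close>.  So \<open>\<bar>T(\<i> y)\<bar>\<close>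
  starts at \<open>1\<close> and decreases in the first and last case, but increases in the other two, where
  points of the imaginary axis arbitrarily close to \<open>0\<close> violate the bound.  Negative \<open>y\<close> are covered
  by conjugation.
\<close>

definition exp_section :: "nat \<Rightarrow> complex \<Rightarrow> complex" where
  "exp_section n w = (\<Sum>k\<le>n. w ^ k / fact k)"

lemma scaled_exp_poly_eq_exp_section: "scaled_exp_poly n z = exp_section n (of_nat n * z)"
  by (simp add: scaled_exp_poly_def exp_section_def atMost_atLeast0)

lemma exp_section_0 [simp]: "exp_section n 0 = 1"
  by (induction n) (auto simp: exp_section_def)

lemma exp_section_cnj: "exp_section n (cnj w) = cnj (exp_section n w)"
  by (simp add: exp_section_def)

lemma has_field_derivative_exp_section:
  "(exp_section n has_field_derivative (exp_section n w - w ^ n / fact n)) (at w)"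
proof (induction n)
  case 0
  then show ?case by (simp add: exp_section_def)
next
  case (Suc n)
  have "((\<lambda>w. w ^ Suc n / fact (Suc n)) has_field_derivative
      (of_nat (Suc n) * w ^ n / fact (Suc n) :: complex)) (at w)"
    using DERIV_cdivide[OF DERIV_power[OF DERIV_ident, of "Suc n"], of "fact (Suc n)"]
    by (simp del: of_nat_Suc fact_Suc power_Suc)
  moreover have "of_nat (Suc n) * w ^ n / fact (Suc n) = (w ^ n / fact n :: complex)"
    by (simp del: of_nat_Suc)
  ultimately have "((\<lambda>w. w ^ Suc n / fact (Suc n)) has_field_derivative (w ^ n / fact n)) (at w)"
    by (simp only:)
  from DERIV_add[OF Suc this] show ?case
    by (simp add: exp_section_def [abs_def])
qed

lemma continuous_on_exp_section [continuous_intros]: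
  "continuous_on S f \<Longrightarrow> continuous_on S (\<lambda>x. exp_section n (f x))"
  unfolding exp_section_def by (intro continuous_intros) auto

lemma DERIV_cmod_power2:
  assumes "(f has_vector_derivative f') (at t)"
  shows "((\<lambda>t. (cmod (f t))\<^sup>2) has_real_derivative (2 * Re (cnj (f t) * f'))) (at t)"
proof -
  have "((\<lambda>t. Re (f t)) has_real_derivative Re f') (at t)"
    and "((\<lambda>t. Im (f t)) has_real_derivative Im f') (at t)"
    using assms by (simp_all add: has_vector_derivative_complex_iff)
  then have "((\<lambda>t. (Re (f t))\<^sup>2 + (Im (f t))\<^sup>2) has_real_derivative
      2 * Re (f t) * Re f' + 2 * Im (f t) * Im f') (at t)"
    using DERIV_add[OF DERIV_power[of "\<lambda>t. Re (f t)" _ _ _ 2] DERIV_power[of "\<lambda>t. Im (f t)" _ _ _ 2]]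
    by (simp add: mult_ac)
  then show ?thesis
    by (simp add: cmod_power2 algebra_simps)
qed

lemma DERIV_cmod_exp_section_line:
  fixes a d :: complex and t :: real
  defines "w \<equiv> a + of_real t * d"
  shows "((\<lambda>t. (cmod (exp_section n (a + of_real t * d)))\<^sup>2) has_real_derivative
      2 * Re (cnj (exp_section n w) * (d * (exp_section n w - w ^ n / fact n)))) (at t)"
  unfolding w_def
proof (rule DERIV_cmod_power2[of "\<lambda>t. exp_section n (a + of_real t * d)"])
  have "((\<lambda>t. a + of_real t * d) has_vector_derivative d) (at t)"
    by (auto intro!: derivative_eq_intros)
  from field_vector_diff_chain_at[OF this, of "exp_section n"]
  show "((\<lambda>t. exp_section n (a + of_real t * d)) has_vector_derivative
      d * (exp_section n (a + of_real t * d) - (a + of_real t * d) ^ n / fact n)) (at t)"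
    using has_field_derivative_exp_section by (simp add: o_def)
qed

text \<open>At the origin \<open>exp_section n\<close> and its derivative both equal \<open>1\<close> (for the derivative, because
  \<open>n > 0\<close>), so by continuity the modulus grows with the real part in a whole disk around \<open>0\<close>.\<close>

lemma cmod_exp_section_le_imaginary_axis:
  assumes "n > 0"
  obtains r where "r > 0"
    "\<And>w. cmod w < r \<Longrightarrow> Re w \<le> 0 \<Longrightarrow>
       cmod (exp_section n w) \<le> cmod (exp_section n (\<i> * of_real (Im w)))"
proof -
  define G where "G w = Re (cnj (exp_section n w) * (exp_section n w - w ^ n / fact n))" for w
  have "continuous_on UNIV G"
    unfolding G_def by (intro continuous_intros) auto
  then have "(G \<longlongrightarrow> G 0) (nhds 0)"
    by (simp add: continuous_on_eq_continuous_at isCont_def flip: tendsto_at_iff_tendsto_nhds)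
  moreover have "G 0 = 1"
    using assms by (simp add: G_def zero_power)
  ultimately have "eventually (\<lambda>w. G w > 0) (nhds 0)"
    by (intro order_tendstoD(1)[of G 1]) auto
  then obtain r where r: "r > 0" "\<And>w. cmod w < r \<Longrightarrow> G w > 0"
    by (auto simp: eventually_nhds_metric)
  have "cmod (exp_section n w) \<le> cmod (exp_section n (\<i> * of_real (Im w)))"
    if w: "cmod w < r" "Re w \<le> 0" for w
  proof -
    define g where "g x = (cmod (exp_section n (\<i> * of_real (Im w) + of_real x * 1)))\<^sup>2" for x
    have "g (Re w) \<le> g 0"
    proof (rule DERIV_nonneg_imp_nondecreasing[OF w(2)])
      fix x assume x: "Re w \<le> x" "x \<le> 0"
      define v where "v = \<i> * of_real (Im w) + of_real x * 1"
      have "cmod v \<le> cmod w"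
        using x by (simp add: v_def cmod_def flip: abs_le_square_iff)
      then have "G v > 0"
        using w r by simp
      moreover have "(g has_real_derivative 2 * G v) (at x)"
        using DERIV_cmod_exp_section_line[of n "\<i> * of_real (Im w)" 1 x]
        by (simp add: g_def [abs_def] G_def v_def)
      ultimately show "\<exists>y. (g has_real_derivative y) (at x) \<and> 0 \<le> y"
        by (intro exI[of _ "2 * G v"]) simp
    qed
    moreover have "\<i> * of_real (Im w) + of_real (Re w) = w"
      by (simp add: complex_eq_iff)
    ultimately show ?thesis
      by (simp add: g_def)
  qed
  with r(1) show thesis by (rule that)
qed

lemma DERIV_cmod_exp_section_imaginary_axis:
  "((\<lambda>y. (cmod (exp_section n (\<i> * of_real y)))\<^sup>2) has_real_derivative
     - (2 * y ^ n / fact n * Re (\<i> ^ Suc n * cnj (exp_section n (\<i> * of_real y))))) (at y)"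
proof -
  define T where "T = exp_section n (\<i> * of_real y)"
  \<comment> \<open>The first summand is \<open>\<i> * \<bar>T\<bar>\<^sup>2\<close>, which is purely imaginary.\<close>
  have "cnj T * (\<i> * (T - (\<i> * of_real y) ^ n / fact n))
      = \<i> * (T * cnj T) - of_real (y ^ n / fact n) * (\<i> ^ Suc n * cnj T)"
    by (simp add: algebra_simps power_mult_distrib)
  also have "Re \<dots> = - (y ^ n / fact n * Re (\<i> ^ Suc n * cnj T))"
  proof -
    have "Re (\<i> * (t * cnj t) - of_real c * z) = - (c * Re z)" for t z c
      by simp
    then show ?thesis .
  qed
  finally have eq: "Re (cnj T * (\<i> * (T - (\<i> * of_real y) ^ n / fact n)))
      = - (y ^ n / fact n * Re (\<i> ^ Suc n * cnj T))" .
  have "((\<lambda>y. (cmod (exp_section n (\<i> * of_real y)))\<^sup>2) has_real_derivative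
      2 * Re (cnj T * (\<i> * (T - (\<i> * of_real y) ^ n / fact n)))) (at y)"
    using DERIV_cmod_exp_section_line[of n 0 \<i> y]
    by (simp only: T_def add_0_left mult.commute[of _ \<i>])
  then show ?thesis
    unfolding eq by (simp add: T_def mult.assoc del: power_Suc)
qed

text \<open>This is \<open>T(\<i> y) = 1 + \<i> y + O(y\<^sup>2)\<close> in the form in which it is used.  The imaginary part vanishes
  at \<open>y = 0\<close>; its sign comes from its derivative there, which is \<open>1\<close>.\<close>

lemma exp_section_imaginary_axis_first_quadrant:
  assumes "n > 0"
  obtains d where "d > 0"
    "\<And>y. 0 < y \<Longrightarrow> y < d \<Longrightarrow>
       Re (exp_section n (\<i> * of_real y)) > 0 \<and> Im (exp_section n (\<i> * of_real y)) > 0"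
proof -
  have "((\<lambda>y. \<i> * of_real y) has_vector_derivative \<i>) (at 0)"
    by (auto intro!: derivative_eq_intros)
  from field_vector_diff_chain_at[OF this, of "exp_section n" 1]
  have "((\<lambda>y. exp_section n (\<i> * of_real y)) has_vector_derivative \<i>) (at 0)"
    using has_field_derivative_exp_section[of n 0] assms by (simp add: o_def zero_power)
  then have "((\<lambda>y. Im (exp_section n (\<i> * of_real y))) has_real_derivative 1) (at 0)"
    by (simp add: has_vector_derivative_complex_iff)
  from DERIV_pos_inc_right[OF this] obtain d1 where d1: "d1 > 0"
    "\<And>y. 0 < y \<Longrightarrow> y < d1 \<Longrightarrow> Im (exp_section n (\<i> * of_real y)) > 0"
    by auto
  define f where "f y = Re (exp_section n (\<i> * of_real y))" for y
  have "continuous_on UNIV f"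
    unfolding f_def by (intro continuous_intros)
  then have "(f \<longlongrightarrow> f 0) (nhds 0)"
    by (simp add: continuous_on_eq_continuous_at isCont_def flip: tendsto_at_iff_tendsto_nhds)
  then have "eventually (\<lambda>y. f y > 0) (nhds 0)"
    by (rule order_tendstoD(1)) (simp add: f_def)
  then obtain d2 where d2: "d2 > 0"
    "\<And>y::real. \<bar>y\<bar> < d2 \<Longrightarrow> Re (exp_section n (\<i> * of_real y)) > 0"
    by (auto simp: eventually_nhds_metric f_def)
  show thesis
    by (rule that[of "min d1 d2"]) (use d1 d2 in auto)
qed

lemma i_power_Suc:
  "\<i> ^ Suc n =
    (if n mod 4 = 0 then \<i> else if n mod 4 = 1 then -1 else if n mod 4 = 2 then -\<i> else 1)"
proof -
  have i4: "\<i> ^ 4 = 1"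
    by simp
  have "\<i> ^ Suc n = \<i> ^ (4 * (n div 4) + Suc (n mod 4))"
    by simp
  also have "\<dots> = \<i> ^ Suc (n mod 4)"
    by (simp only: power_add power_mult i4 power_one mult_1_left)
  finally have *: "\<i> ^ Suc n = \<i> ^ Suc (n mod 4)" .
  have "n mod 4 < 4"
    by simp
  then consider "n mod 4 = 0" | "n mod 4 = 1" | "n mod 4 = 2" | "n mod 4 = 3"
    by linarith
  then show ?thesis
    by cases (simp_all only: *, simp_all add: power3_eq_cube)
qed

text \<open>Both directions of the equivalence come from here: the factor \<open>\<i> ^ (n+1)\<close> in the derivative
  along the imaginary axis has period \<open>4\<close> in \<open>n\<close> and selects \<open>\<plusminus> Re\<close> or \<open>\<plusminus> Im\<close> of a number in the first
  quadrant.\<close>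

lemma cmod_exp_section_imaginary_axis:
  assumes "n > 0"
  obtains d where "d > 0"
    "\<And>y. 0 < y \<Longrightarrow> y < d \<Longrightarrow>
       (if n mod 4 = 0 \<or> n mod 4 = 3 then cmod (exp_section n (\<i> * of_real y)) < 1
        else cmod (exp_section n (\<i> * of_real y)) > 1)"
proof -
  obtain d where d: "d > 0"
    "\<And>y. 0 < y \<Longrightarrow> y < d \<Longrightarrow>
       Re (exp_section n (\<i> * of_real y)) > 0 \<and> Im (exp_section n (\<i> * of_real y)) > 0"
    using exp_section_imaginary_axis_first_quadrant[OF assms] by blast
  define g where "g y = (cmod (exp_section n (\<i> * of_real y)))\<^sup>2" for y
  define H where "H y = Re (\<i> ^ Suc n * cnj (exp_section n (\<i> * of_real y)))" for y
  have g': "(g has_real_derivative - (2 * y ^ n / fact n * H y)) (at y)" for y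
    unfolding g_def H_def by (rule DERIV_cmod_exp_section_imaginary_axis)
  have cont: "continuous_on A g" for A
    using g' by (meson DERIV_isCont continuous_at_imp_continuous_on)
  have g0: "g 0 = 1"
    by (simp add: g_def)
  have "if n mod 4 = 0 \<or> n mod 4 = 3 then cmod (exp_section n (\<i> * of_real y)) < 1
      else cmod (exp_section n (\<i> * of_real y)) > 1" if y: "0 < y" "y < d" for y
  proof (cases "n mod 4 = 0 \<or> n mod 4 = 3")
    case True
    have H: "H t > 0" if "0 < t" "t < y" for t
      using True d(2)[of t] that y by (auto simp: H_def i_power_Suc simp del: power_Suc)
    have "g y < g 0"
    proof (intro DERIV_neg_imp_decreasing_open[OF y(1) _ cont])
      fix t assume t: "0 < t" "t < y"
      with H have "- (2 * t ^ n / fact n * H t) < 0"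
        by simp
      with g' show "\<exists>D. (g has_real_derivative D) (at t) \<and> D < 0"
        by blast
    qed
    then show ?thesis
      using True by (simp add: g0 g_def power_less_one_iff)
  next
    case False
    moreover have "n mod 4 < 4"
      by simp
    ultimately have "n mod 4 = 1 \<or> n mod 4 = 2"
      by linarith
    then have H: "H t < 0" if "0 < t" "t < y" for t
      using d(2)[of t] that y by (auto simp: H_def i_power_Suc simp del: power_Suc)
    have "g 0 < g y"
    proof (intro DERIV_pos_imp_increasing_open[OF y(1) _ cont])
      fix t assume t: "0 < t" "t < y"
      with H have "- (2 * t ^ n / fact n * H t) > 0"
        by (simp add: mult_pos_neg divide_neg_pos)
      with g' show "\<exists>D. (g has_real_derivative D) (at t) \<and> D > 0"
        by blast
    qed
    then show ?thesis
      using False power_le_one[of "cmod (exp_section n (\<i> * of_real y))" 2]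
      by (force simp: g0 g_def not_less intro: ccontr)
  qed
  with d(1) show thesis by (rule that)
qed

theorem theorem5p1:
  fixes n :: nat
  assumes "n > 0"
  shows "(\<exists>\<rho>::real. \<rho> > 0 \<and> cball (0::complex) \<rho> \<inter> {z. Re z \<le> 0} \<subseteq> stability_set n)
    \<longleftrightarrow> [n = 0] (mod 4) \<or> [n = 3] (mod 4)"
proof -
  obtain d where d: "d > 0"
    "\<And>y. 0 < y \<Longrightarrow> y < d \<Longrightarrow>
       (if n mod 4 = 0 \<or> n mod 4 = 3 then cmod (exp_section n (\<i> * of_real y)) < 1
        else cmod (exp_section n (\<i> * of_real y)) > 1)"
    using cmod_exp_section_imaginary_axis[OF assms] by blast
  obtain r where r: "r > 0"
    "\<And>w. cmod w < r \<Longrightarrow> Re w \<le> 0 \<Longrightarrow>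
       cmod (exp_section n w) \<le> cmod (exp_section n (\<i> * of_real (Im w)))"
    using cmod_exp_section_le_imaginary_axis[OF assms] by blast
  have "(\<exists>\<rho>::real. \<rho> > 0 \<and> cball (0::complex) \<rho> \<inter> {z. Re z \<le> 0} \<subseteq> stability_set n)
    \<longleftrightarrow> n mod 4 = 0 \<or> n mod 4 = 3"
  proof
    assume "\<exists>\<rho>::real. \<rho> > 0 \<and> cball (0::complex) \<rho> \<inter> {z. Re z \<le> 0} \<subseteq> stability_set n"
    then obtain \<rho> :: real where \<rho>: "\<rho> > 0"
      "cball (0::complex) \<rho> \<inter> {z. Re z \<le> 0} \<subseteq> stability_set n"
      by blast
    define y where "y = min \<rho> (d / (2 * n))"
    have y: "0 < y" "y \<le> \<rho>" "n * y < d"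
    proof -
      show "0 < y" "y \<le> \<rho>"
        using \<rho> d assms by (auto simp: y_def)
      have "n * y \<le> n * (d / (2 * n))"
        by (intro mult_left_mono) (auto simp: y_def)
      also have "\<dots> < d"
        using d assms by simp
      finally show "n * y < d" .
    qed
    then have "\<i> * of_real y \<in> stability_set n"
      using \<rho> by (intro subsetD[OF \<rho>(2)]) (auto simp: norm_mult)
    then have "cmod (exp_section n (\<i> * of_real (n * y))) \<le> 1"
      by (simp add: stability_set_def scaled_exp_poly_eq_exp_section mult_ac)
    with d(2)[of "n * y"] y assms show "n mod 4 = 0 \<or> n mod 4 = 3"
      by (auto split: if_splits)
  next
    assume n: "n mod 4 = 0 \<or> n mod 4 = 3"
    have axis: "cmod (exp_section n (\<i> * of_real y)) \<le> 1" if "\<bar>y\<bar> < d" for y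
    proof -
      have "cnj (exp_section n (\<i> * of_real y)) = exp_section n (\<i> * of_real (- y))"
        by (simp flip: exp_section_cnj)
      then have "cmod (exp_section n (\<i> * of_real y)) = cmod (exp_section n (\<i> * of_real \<bar>y\<bar>))"
        by (metis abs_if complex_mod_cnj)
      with d(2)[of "\<bar>y\<bar>"] that n show ?thesis
        by (cases "y = 0") auto
    qed
    define \<rho> where "\<rho> = min r d / (2 * n)"
    have "z \<in> stability_set n" if z: "cmod z \<le> \<rho>" "Re z \<le> 0" for z
    proof -
      define w where "w = of_nat n * z"
      have "cmod w \<le> n * \<rho>"
        using z by (simp add: w_def norm_mult mult_left_mono)
      also have "\<dots> < min r d"
        using \<open>r > 0\<close> \<open>d > 0\<close> assms by (simp add: \<rho>_def min_def)
      finally have w: "cmod w < r" "cmod w < d"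
        by auto
      have "cmod (exp_section n w) \<le> cmod (exp_section n (\<i> * of_real (Im w)))"
        by (rule r(2)[OF w(1)]) (use z in \<open>simp add: w_def mult_nonneg_nonpos\<close>)
      also have "\<dots> \<le> 1"
        using abs_Im_le_cmod[of w] w by (intro axis) simp
      finally show ?thesis
        by (simp add: stability_set_def scaled_exp_poly_eq_exp_section w_def)
    qed
    moreover have "\<rho> > 0"
      using r d assms by (simp add: \<rho>_def)
    ultimately show
      "\<exists>\<rho>::real. \<rho> > 0 \<and> cball (0::complex) \<rho> \<inter> {z. Re z \<le> 0} \<subseteq> stability_set n"
      by (intro exI[of _ \<rho>]) auto
  qed
  then show ?thesis
    by (simp add: cong_def)
qed

end
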